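(* Let $a>0$ and $\beta=\begin{pmatrix}0 & -a \\ a & 0\end{pmatrix}\in\mathfrak{so}(2)$, and let $SO(2)$ be the Lie group of rotations $\begin{pmatrix}\cos t & -\sin t \\ \sin t & \cos t\end{pmatrix}$, $t\in\mathbb{R}$. Let $\eta(\beta)=\begin{pmatrix}0 & -\frac1a \\ \frac1a & 0\end{pmatrix}$. Then for all $g\in SO(2)$, $$\eta(\mathrm{Ad}_g(\beta))=\mathrm{Ad}^*_g(\eta(\beta)).$$ Consequently the unique group one-cocycle $\theta$ determined by $\eta(\mathrm{Ad}_g(\beta))=\mathrm{Ad}_g^*(\eta(\beta))+\theta(g)$ is $\theta(g)=0$ (the zero $2\times2$ matrix) for every $g\in SO(2)$, and the associated Lie algebra one-cocycle satisfies $\Theta(X)=0$ for all $X\in\mathfrak{so}(2)$.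
   Context: $\mathfrak{so}(2)$ is the Lie algebra of real antisymmetric $2\times2$ matrices, with inner product $\langle X,Y\rangle=\frac12\mathrm{Tr}(X^TY)$, which is used to identify $\mathfrak{so}(2)^*$ with $\mathfrak{so}(2)$. The adjoint action is $\mathrm{Ad}_g(X)=gXg^{-1}$, and the coadjoint action is defined by $\langle\mathrm{Ad}^*_gF,Y\rangle=\langle F,\mathrm{Ad}_{g^{-1}}Y\rangle$. The map $\eta$ is $\eta(\beta)=\frac{\partial\Phi}{\partial\beta}(\beta)$, the gradient with respect to $\langle\cdot,\cdot\rangle$ of $\Phi(\beta)=\log(2a)$, where $\beta=\begin{pmatrix}0 & -a \\ a & 0\end{pmatrix}$ with $a>0$. Explicitly $\eta(\beta)=\beta/\langle\beta,\beta\rangle=\frac1{a^2}\beta$. The group one-cocycle $\theta:SO(2)\to\mathfrak{so}(2)^*\cong\mathfrak{so}(2)$ measures the failure of equivariance of $\eta$ and is defined by $\eta(\mathrm{Ad}_g(\beta))=\mathrm{Ad}^*_g(\eta(\beta))+\theta(g)$. The associated Lie algebra one-cocycle is its differential at the identity, $\Theta(X)=T_e\theta(X)$ for $X\in\mathfrak{so}(2)$. *)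

theory Defs
  imports "HOL-Analysis.Analysis"
begin

definition so2 :: "(real^2^2) set" where
  "so2 = {X. transpose X = - X}"

definition SO2 :: "(real^2^2) set" where
  "SO2 = range (\<lambda>t. vector [vector [cos t, - sin t], vector [sin t, cos t]])"

definition ip :: "real^2^2 \<Rightarrow> real^2^2 \<Rightarrow> real" where
  "ip X Y = 1/2 * trace (transpose X ** Y)"

definition Ad :: "real^2^2 \<Rightarrow> real^2^2 \<Rightarrow> real^2^2" where
  "Ad g X = g ** X ** matrix_inv g"

text \<open>The dual of \<open>so2\<close> is identified with \<open>so2\<close> through \<open>ip\<close>, so the coadjoint action takes
  values in \<open>so2\<close>.\<close>

definition coAd :: "real^2^2 \<Rightarrow> real^2^2 \<Rightarrow> real^2^2" where
  "coAd g F = (THE Z. Z \<in> so2 \<and> (\<forall>Y\<in>so2. ip Z Y = ip F (Ad (matrix_inv g) Y)))"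

text \<open>The lower left entry of \<open>B \<in> so2\<close> is the parameter \<open>a\<close>; only \<open>B\<close> with \<open>a > 0\<close> are relevant.\<close>

definition Phi :: "real^2^2 \<Rightarrow> real" where
  "Phi B = ln (2 * B $ 2 $ 1)"

definition is_grad :: "(real^2^2 \<Rightarrow> real) \<Rightarrow> real^2^2 \<Rightarrow> real^2^2 \<Rightarrow> bool" where
  "is_grad f B G \<longleftrightarrow> G \<in> so2 \<and> (f has_derivative (\<lambda>Y. ip G Y)) (at B within so2)"

definition eta :: "real^2^2 \<Rightarrow> real^2^2" where
  "eta B = (THE G. is_grad Phi B G)"

definition group_one_cocycle :: "(real^2^2 \<Rightarrow> real^2^2) \<Rightarrow> bool" where
  "group_one_cocycle \<theta> \<longleftrightarrow>
     (\<forall>g\<in>SO2. \<theta> g \<in> so2) \<and>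
     (\<forall>g\<in>SO2. \<forall>h\<in>SO2. \<theta> (g ** h) = \<theta> g + coAd g (\<theta> h))"

text \<open>\<open>Z\<close> is the image of the tangent vector \<open>X\<close> under the differential of \<open>\<theta>\<close> at the identity:
  every curve in \<open>SO2\<close> through the identity with velocity \<open>X\<close> is mapped by \<open>\<theta>\<close> to a curve
  with velocity \<open>Z\<close>. Only the values of \<open>\<theta>\<close> on \<open>SO2\<close> matter.\<close>

definition has_differential_at_id ::
    "(real^2^2 \<Rightarrow> real^2^2) \<Rightarrow> real^2^2 \<Rightarrow> real^2^2 \<Rightarrow> bool" where
  "has_differential_at_id \<theta> X Z \<longleftrightarrow>
     (\<forall>c :: real \<Rightarrow> real^2^2.
        (\<forall>t. c t \<in> SO2) \<and> c 0 = mat 1 \<and> (c has_vector_derivative X) (at 0) \<longrightarrow>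
        ((\<lambda>t. \<theta> (c t)) has_vector_derivative Z) (at 0))"

definition Lie_algebra_cocycle :: "(real^2^2 \<Rightarrow> real^2^2) \<Rightarrow> real^2^2 \<Rightarrow> real^2^2" where
  "Lie_algebra_cocycle \<theta> X = (THE Z. has_differential_at_id \<theta> X Z)"

end

theory Submission
  imports Defs
begin

text \<open>The group of plane rotations is commutative and its Lie algebra is the line spanned by the
  quarter turn, so rotations commute with every antisymmetric matrix: the adjoint action on that
  line is trivial (\<open>Ad_trivial\<close>), and so is its dual, the coadjoint action (\<open>coAd_trivial\<close>).
  Equivariance of the gradient map then says that one and the same matrix equals itself, provided
  the gradient at \<open>\<beta>\<close> is antisymmetric, which \<open>eta_skew\<close> makes explicit. The defect of
  equivariance is therefore zero at every rotation.

  The differential of a vanishing cocycle vanishes along every curve. That zero is the only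
  candidate needs an actual curve: each antisymmetric matrix is the initial velocity of a
  one-parameter group of rotations (\<open>rot_curve_has_vector_derivative\<close>), and velocities are unique.\<close>

definition skew :: "real \<Rightarrow> real^2^2" where
  "skew b = vector [vector [0, - b], vector [b, 0]]"

definition rot :: "real \<Rightarrow> real^2^2" where
  "rot t = vector [vector [cos t, - sin t], vector [sin t, cos t]]"

lemma skew_nth [simp]:
  "skew b $ 1 $ 1 = 0" "skew b $ 1 $ 2 = - b" "skew b $ 2 $ 1 = b" "skew b $ 2 $ 2 = 0"
  by (simp_all add: skew_def)

lemma rot_nth [simp]:
  "rot t $ 1 $ 1 = cos t" "rot t $ 1 $ 2 = - sin t" "rot t $ 2 $ 1 = sin t" "rot t $ 2 $ 2 = cos t"
  by (simp_all add: rot_def)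

lemma SO2_eq_range_rot: "SO2 = range rot"
  unfolding SO2_def rot_def ..

lemma so2_eq_range_skew: "so2 = range skew"
proof (intro equalityI subsetI)
  fix X assume "X \<in> so2"
  then have skew: "transpose X = - X" by (simp add: so2_def)
  have entries: "X $ j $ i = - X $ i $ j" for i j
  proof -
    have "X $ j $ i = transpose X $ i $ j" by (simp add: transpose_def)
    then show ?thesis by (simp only: skew vector_uminus_component)
  qed
  have "X $ i $ i = 0" for i using entries[of i i] by linarith
  moreover have "X $ 1 $ 2 = - X $ 2 $ 1" by (rule entries)
  ultimately have "X = skew (X $ 2 $ 1)"
    unfolding vec_eq_iff forall_2 by simp
  then show "X \<in> range skew" by blast
next
  fix X assume "X \<in> range skew"
  then obtain b where b: "X = skew b" by blast
  have "transpose (skew b) = - skew b"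
    unfolding vec_eq_iff forall_2 by (simp add: transpose_def)
  then show "X \<in> so2" by (simp add: so2_def b)
qed

lemma skew_in_so2 [simp]: "skew b \<in> so2"
  by (simp add: so2_eq_range_skew)

lemma linear_skew: "linear skew"
  by (rule linearI) (simp_all add: vec_eq_iff forall_2)

lemma skew_0: "skew 0 = 0"
  by (simp add: vec_eq_iff forall_2)

lemma rot_0: "rot 0 = mat 1"
  by (simp add: vec_eq_iff forall_2 mat_def)

lemma rot_mult: "rot s ** rot t = rot (s + t)"
  by (simp add: vec_eq_iff forall_2 matrix_matrix_mult_def sum_2 cos_add sin_add)

lemma SO2_mult_closed: "g \<in> SO2 \<Longrightarrow> h \<in> SO2 \<Longrightarrow> g ** h \<in> SO2"
  by (auto simp: SO2_eq_range_rot rot_mult)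

lemma matrix_inv_rot: "matrix_inv (rot t) = rot (- t)"
  unfolding matrix_inv_def
proof (rule some_equality)
  show "rot t ** rot (- t) = mat 1 \<and> rot (- t) ** rot t = mat 1"
    by (simp add: rot_mult rot_0)
  fix B assume "rot t ** B = mat 1 \<and> B ** rot t = mat 1"
  then have "(rot (- t) ** rot t) ** B = rot (- t) ** mat 1"
    by (simp add: matrix_mul_assoc[symmetric])
  then show "B = rot (- t)"
    by (simp add: rot_mult rot_0)
qed

lemma rot_skew_commute: "rot t ** skew b = skew b ** rot t"
  by (simp add: vec_eq_iff forall_2 matrix_matrix_mult_def sum_2)

lemma Ad_trivial:
  assumes "g \<in> SO2" "X \<in> so2"
  shows "Ad g X = X"
proof -
  obtain t b where "g = rot t" "X = skew b"
    using assms by (auto simp: SO2_eq_range_rot so2_eq_range_skew)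
  then show ?thesis
    by (simp add: Ad_def matrix_inv_rot rot_skew_commute matrix_mul_assoc[symmetric] rot_mult rot_0)
qed

text \<open>For antisymmetric \<open>Y\<close> this is the product of the two parameters. Differentiability of
  \<open>Phi\<close> within the line of antisymmetric matrices is stated with a linear form on all matrices,
  which is why the second argument is arbitrary.\<close>

lemma ip_skew: "ip (skew b) Y = b * (Y $ 2 $ 1 - Y $ 1 $ 2) / 2"
  by (simp add: ip_def trace_def transpose_def matrix_matrix_mult_def sum_2 algebra_simps)

text \<open>A trivial adjoint action leaves \<open>F\<close> itself as a candidate for the dual action, and
  nondegeneracy of the inner product on the antisymmetric matrices leaves no other.\<close>

lemma coAd_trivial:
  assumes "g \<in> SO2" "F \<in> so2"
  shows "coAd g F = F"
  unfolding coAd_def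
proof (rule the_equality)
  have inv: "matrix_inv g \<in> SO2"
    using assms(1) by (auto simp: SO2_eq_range_rot matrix_inv_rot)
  show "F \<in> so2 \<and> (\<forall>Y\<in>so2. ip F Y = ip F (Ad (matrix_inv g) Y))"
    using assms(2) by (simp add: Ad_trivial[OF inv])
  fix Z assume Z: "Z \<in> so2 \<and> (\<forall>Y\<in>so2. ip Z Y = ip F (Ad (matrix_inv g) Y))"
  obtain z f where zf: "Z = skew z" "F = skew f"
    using Z assms(2) by (auto simp: so2_eq_range_skew)
  have "ip Z (skew 1) = ip F (skew 1)"
    using Z by (simp add: Ad_trivial[OF inv])
  then show "Z = F" by (simp add: zf ip_skew)
qed

text \<open>On antisymmetric matrices \<open>2 * B $ 2 $ 1 = B $ 2 $ 1 - B $ 1 $ 2\<close>, and in this symmetrised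
  form the derivative of \<open>Phi\<close> is represented by an antisymmetric matrix. Restriction to
  the line of antisymmetric matrices, where \<open>Phi\<close> is the logarithm of twice the parameter,
  shows that no other antisymmetric matrix represents it.\<close>

lemma eta_skew:
  assumes "a > 0"
  shows "eta (skew a) = skew (1 / a)"
  unfolding eta_def
proof (rule the_equality)
  have entry: "((\<lambda>B::real^2^2. B $ i $ j) has_derivative (\<lambda>B. B $ i $ j)) F" for i j F
    by (intro bounded_linear_imp_has_derivative
        bounded_linear_compose[OF bounded_linear_vec_nth bounded_linear_vec_nth])
  have "((\<lambda>B::real^2^2. ln (B $ 2 $ 1 - B $ 1 $ 2)) has_derivative ip (skew (1 / a)))
          (at (skew a) within so2)"
    unfolding ip_skew[abs_def]
    using assms by (auto intro!: derivative_eq_intros entry simp: field_simps)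
  moreover have "Phi B = ln (B $ 2 $ 1 - B $ 1 $ 2)" if "B \<in> so2" for B
    using that by (auto simp: so2_eq_range_skew Phi_def)
  ultimately have "(Phi has_derivative ip (skew (1 / a))) (at (skew a) within so2)"
    by (rule has_derivative_transform[OF skew_in_so2, rotated])
  then show "is_grad Phi (skew a) (skew (1 / a))"
    by (simp add: is_grad_def)
next
  fix G assume G: "is_grad Phi (skew a) G"
  then obtain b where b: "G = skew b"
    by (auto simp: is_grad_def so2_eq_range_skew)
  have "(Phi has_derivative ip G) (at (skew a) within range skew)"
    using G by (simp add: is_grad_def so2_eq_range_skew)
  moreover have "(skew has_derivative skew) (at a)"
    using linear_skew by (simp add: bounded_linear_imp_has_derivative linear_conv_bounded_linear)
  ultimately have "((\<lambda>x. Phi (skew x)) has_derivative (\<lambda>y. ip G (skew y))) (at a)"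
    using has_derivative_in_compose by blast
  then have "((\<lambda>x. ln (2 * x)) has_derivative (*) b) (at a)"
    by (simp add: Phi_def b ip_skew)
  then have "((\<lambda>x. ln (2 * x)) has_real_derivative b) (at a)"
    by (simp add: has_field_derivative_def)
  moreover have "((\<lambda>x. ln (2 * x)) has_real_derivative 1 / a) (at a)"
    using assms by (auto intro!: derivative_eq_intros simp: field_simps)
  ultimately have "b = 1 / a" by (rule DERIV_unique)
  then show "G = skew (1 / a)" by (simp add: b)
qed

lemma group_one_cocycle_zero:
  assumes "\<And>g. g \<in> SO2 \<Longrightarrow> \<theta> g = 0"
  shows "group_one_cocycle \<theta>"
proof -
  have "0 \<in> so2" using skew_in_so2[of 0] by (simp add: skew_0)
  then show ?thesis
    by (simp add: group_one_cocycle_def assms SO2_mult_closed coAd_trivial)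
qed

lemma rot_curve_has_vector_derivative:
  "((\<lambda>t. rot (b * t)) has_vector_derivative skew b) (at 0)"
proof -
  have "(\<lambda>t. rot (b * t)) = (\<lambda>t. cos (b * t) *\<^sub>R mat 1 + sin (b * t) *\<^sub>R skew 1)"
    by (simp add: fun_eq_iff vec_eq_iff forall_2 mat_def)
  moreover have "skew b = b *\<^sub>R skew 1"
    by (simp add: vec_eq_iff forall_2)
  ultimately show ?thesis
    by (auto intro!: derivative_eq_intros)
qed

lemma has_differential_at_id_zero_iff:
  assumes "\<And>g. g \<in> SO2 \<Longrightarrow> \<theta> g = 0" "X \<in> so2"
  shows "has_differential_at_id \<theta> X Z \<longleftrightarrow> Z = 0"
proof
  assume Z: "has_differential_at_id \<theta> X Z"
  obtain b where b: "X = skew b" using assms(2) by (auto simp: so2_eq_range_skew)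
  \<comment> \<open>Without a curve of velocity \<open>X\<close> in the group, every \<open>Z\<close> would qualify.\<close>
  have in_group: "rot (b * t) \<in> SO2" for t by (simp add: SO2_eq_range_rot)
  then have "((\<lambda>t. \<theta> (rot (b * t))) has_vector_derivative Z) (at 0)"
    using Z rot_curve_has_vector_derivative[of b]
    by (simp add: has_differential_at_id_def b rot_0)
  then have "((\<lambda>t::real. 0) has_vector_derivative Z) (at 0)"
    by (simp add: assms(1) in_group)
  then show "Z = 0"
    using has_vector_derivative_const vector_derivative_unique_at by blast
next
  assume "Z = 0"
  then show "has_differential_at_id \<theta> X Z"
    by (simp add: has_differential_at_id_def assms(1))
qed

theorem theorem4:
  fixes a :: real and \<beta> :: "real^2^2"
  assumes "a > 0"
    and "\<beta> = vector [vector [0, - a], vector [a, 0]]"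
  shows "eta \<beta> = vector [vector [0, - (1 / a)], vector [1 / a, 0]]
    \<and> (\<forall>g\<in>SO2. eta (Ad g \<beta>) = coAd g (eta \<beta>))
    \<and> (\<exists>!\<theta>. \<theta> \<in> extensional SO2 \<and> group_one_cocycle \<theta> \<and>
          (\<forall>g\<in>SO2. eta (Ad g \<beta>) = coAd g (eta \<beta>) + \<theta> g))
    \<and> (\<forall>\<theta>. (\<forall>g\<in>SO2. eta (Ad g \<beta>) = coAd g (eta \<beta>) + \<theta> g) \<longrightarrow>
          group_one_cocycle \<theta> \<and>
          (\<forall>g\<in>SO2. \<theta> g = 0) \<and>
          (\<forall>X\<in>so2. (\<exists>!Z. has_differential_at_id \<theta> X Z) \<and> Lie_algebra_cocycle \<theta> X = 0))"
proof -
  have \<beta>: "\<beta> = skew a" by (simp add: assms(2) skew_def)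
  have eta: "eta \<beta> = skew (1 / a)" by (simp add: \<beta> eta_skew assms(1))
  have equivariant: "eta (Ad g \<beta>) = coAd g (eta \<beta>)" if "g \<in> SO2" for g
    using that by (simp add: coAd_trivial eta Ad_trivial \<beta> eta_skew assms(1))
  have defect_iff: "(\<forall>g\<in>SO2. eta (Ad g \<beta>) = coAd g (eta \<beta>) + \<theta> g) \<longleftrightarrow> (\<forall>g\<in>SO2. \<theta> g = 0)" for \<theta>
    by (simp add: equivariant)
  have unique: "\<exists>!\<theta>. \<theta> \<in> extensional SO2 \<and> group_one_cocycle \<theta> \<and>
      (\<forall>g\<in>SO2. eta (Ad g \<beta>) = coAd g (eta \<beta>) + \<theta> g)"
    unfolding defect_iff
  proof (rule ex1I[of _ "restrict (\<lambda>_. 0) SO2"])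
    show "restrict (\<lambda>_. 0) SO2 \<in> extensional SO2 \<and> group_one_cocycle (restrict (\<lambda>_. 0) SO2) \<and>
        (\<forall>g\<in>SO2. restrict (\<lambda>_. 0) SO2 g = (0 :: real^2^2))"
      by (simp add: group_one_cocycle_zero)
    fix \<theta> :: "real^2^2 \<Rightarrow> real^2^2"
    assume "\<theta> \<in> extensional SO2 \<and> group_one_cocycle \<theta> \<and> (\<forall>g\<in>SO2. \<theta> g = 0)"
    then show "\<theta> = restrict (\<lambda>_. 0) SO2"
      by (auto intro: extensionalityI)
  qed
  have "group_one_cocycle \<theta> \<and> (\<forall>g\<in>SO2. \<theta> g = 0) \<and>
      (\<forall>X\<in>so2. (\<exists>!Z. has_differential_at_id \<theta> X Z) \<and> Lie_algebra_cocycle \<theta> X = 0)"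
    if "\<forall>g\<in>SO2. \<theta> g = 0" for \<theta>
    using that by (simp add: group_one_cocycle_zero has_differential_at_id_zero_iff
        Lie_algebra_cocycle_def)
  then show ?thesis
    using unique equivariant eta by (simp add: defect_iff skew_def)
qed

end
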